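(* Let $\mathcal{C}$ be a pointed category in which every morphism admits an (epi, mono)-factorisation. Assume that $\mathcal{C}$ has pullbacks and pushouts, and that pullbacks preserve normal epimorphisms and pushouts preserve normal monomorphisms. Let $(\mathcal{U},\mathcal{V})$ be a torsion theory in $\mathcal{C}$ and let $\mathcal{S}$ be a monocoreflective and epireflective Serre subcategory of $\mathcal{C}$. Then the pair $(\mathcal{T},\mathcal{F})=(\mathcal{U}\ast\mathcal{S},\ \mathcal{S}\ast\mathcal{V})$ is a pretorsion theory in $\mathcal{C}$ with class of trivial objects $\mathcal{S}$.
   Context: A pointed category is a category with a zero object. In a pointed category, a short exact sequence $0\to A\xrightarrow{f}B\xrightarrow{g}C\to 0$ is a pair of composable morphisms such that $f$ is a kernel of $g$ and $g$ is a cokernel of $f$. A normal epimorphism is a morphism that is the cokernel of some morphism; a normal monomorphism is a morphism that is the kernel of some morphism. "Pullbacks preserve normal epimorphisms" means that the pullback of a normal epimorphism along any morphism is a normal epimorphism; "pushouts preserve normal monomorphisms" is the dual condition. A morphism $f$ admits an (epi, mono)-factorisation if $f=me$ with $m$ a monomorphism and $e$ an epimorphism. Torsion theory: a torsion theory in a pointed category $\mathcal{C}$ is a pair $(\mathcal{U},\mathcal{V})$ of full subcategories of $\mathcal{C}$ closed under isomorphisms such that (i) every morphism from an object of $\mathcal{U}$ to an object of $\mathcal{V}$ is zero; (ii) for every object $X$ of $\mathcal{C}$ there is a short exact sequence $0\to U_X\to X\to V_X\to 0$ with $U_X\in\mathcal{U}$ and $V_X\in\mathcal{V}$. Serre subcategory: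 a full subcategory $\mathcal{S}$ of $\mathcal{C}$ closed under subobjects (the domain of any monomorphism with codomain in $\mathcal{S}$ is in $\mathcal{S}$), quotients (the codomain of any epimorphism with domain in $\mathcal{S}$ is in $\mathcal{S}$) and extensions (if $0\to A\to X\to B\to 0$ is a short exact sequence with $A,B\in\mathcal{S}$, then $X\in\mathcal{S}$). $\mathcal{S}$ is monocoreflective if the inclusion $\mathcal{S}\to\mathcal{C}$ has a right adjoint and all components of the counit are monomorphisms; it is epireflective if the inclusion has a left adjoint and all components of the unit are epimorphisms. Extensions: for subcategories $\mathcal{A},\mathcal{B}$ of $\mathcal{C}$, $\mathcal{A}\ast\mathcal{B}$ denotes the full subcategory of $\mathcal{C}$ of those objects $X$ for which there is a short exact sequence $0\to A\to X\to B\to 0$ with $A\in\mathcal{A}$ and $B\in\mathcal{B}$. $\mathcal{Z}$-trivial morphisms, $\mathcal{Z}$-kernels, $\mathcal{Z}$-cokernels: let $\mathcal{Z}$ be a class of objects of a category $\mathcal{C}$. A morphism is $\mathcal{Z}$-trivial if it factors through an object of $\mathcal{Z}$; $\mathrm{Triv}(X,Y)$ denotes the class of $\mathcal{Z}$-trivial morphisms $X\to Y$. A morphism $\varepsilon\colon X\to A$ is a $\mathcal{Z}$-kernel of $f\colon A\to A'$ if $f\varepsilon$ is $\mathcal{Z}$-trivial and, whenever $\lambda\colon Y\to A$ is such that $f\lambda$ is $\mathcal{Z}$-trivial, there is a unique $\lambda'\colon Y\to X$ with $\lambda=\varepsilon\lambda'$. $\mathcal{Z}$-cokernels are defined dually.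 A sequence $A\xrightarrow{f}B\xrightarrow{g}C$ is a short $\mathcal{Z}$-exact sequence if $f$ is a $\mathcal{Z}$-kernel of $g$ and $g$ is a $\mathcal{Z}$-cokernel of $f$. Pretorsion theory: a pair $(\mathcal{T},\mathcal{F})$ of full subcategories of a category $\mathcal{C}$ closed under isomorphisms is a pretorsion theory in $\mathcal{C}$ with class of trivial objects $\mathcal{Z}:=\mathcal{T}\cap\mathcal{F}$ if (i) $\mathrm{Hom}(T,F)=\mathrm{Triv}(T,F)$ for all $T\in\mathcal{T}$, $F\in\mathcal{F}$; (ii) for every object $X$ of $\mathcal{C}$ there is a short $\mathcal{Z}$-exact sequence $T_X\to X\to F_X$ with $T_X\in\mathcal{T}$ and $F_X\in\mathcal{F}$. In particular, the claim includes $\mathcal{T}\cap\mathcal{F}=\mathcal{S}$. *)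

theory Defs
  imports Main
begin

section \<open>Categories\<close>

text \<open>A category is given by carrier sets of objects and arrows inside arbitrary types; the
  operations are only meaningful on these carriers, and \<open>g \<cdot>\<^bsub>C\<^esub> f\<close> means ``first \<open>f\<close>, then \<open>g\<close>''.\<close>

record ('o, 'm) category =
  Obj :: "'o set"
  Arr :: "'m set"
  Dom :: "'m \<Rightarrow> 'o"
  Cod :: "'m \<Rightarrow> 'o"
  Id :: "'o \<Rightarrow> 'm"
  Comp :: "'m \<Rightarrow> 'm \<Rightarrow> 'm"  (infixr "\<cdot>\<index>" 70)

definition hom :: "('o, 'm) category \<Rightarrow> 'o \<Rightarrow> 'o \<Rightarrow> 'm set" where
  "hom C X Y = {f \<in> Arr C. Dom C f = X \<and> Cod C f = Y}"

locale category =
  fixes C :: "('o, 'm) category" (structure)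
  assumes dom_obj: "f \<in> Arr C \<Longrightarrow> Dom C f \<in> Obj C"
    and cod_obj: "f \<in> Arr C \<Longrightarrow> Cod C f \<in> Obj C"
    and id_hom: "X \<in> Obj C \<Longrightarrow> Id C X \<in> hom C X X"
    and comp_hom: "\<lbrakk>f \<in> hom C X Y; g \<in> hom C Y Z\<rbrakk> \<Longrightarrow> g \<cdot> f \<in> hom C X Z"
    and comp_id_right: "f \<in> Arr C \<Longrightarrow> f \<cdot> Id C (Dom C f) = f"
    and comp_id_left: "f \<in> Arr C \<Longrightarrow> Id C (Cod C f) \<cdot> f = f"
    and comp_assoc: "\<lbrakk>f \<in> hom C W X; g \<in> hom C X Y; h \<in> hom C Y Z\<rbrakk>
                       \<Longrightarrow> (h \<cdot> g) \<cdot> f = h \<cdot> (g \<cdot> f)"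

definition monic :: "('o, 'm) category \<Rightarrow> 'm \<Rightarrow> bool" where
  "monic C m \<longleftrightarrow> m \<in> Arr C \<and>
     (\<forall>X. \<forall>f \<in> hom C X (Dom C m). \<forall>g \<in> hom C X (Dom C m).
        m \<cdot>\<^bsub>C\<^esub> f = m \<cdot>\<^bsub>C\<^esub> g \<longrightarrow> f = g)"

definition epic :: "('o, 'm) category \<Rightarrow> 'm \<Rightarrow> bool" where
  "epic C e \<longleftrightarrow> e \<in> Arr C \<and>
     (\<forall>Y. \<forall>f \<in> hom C (Cod C e) Y. \<forall>g \<in> hom C (Cod C e) Y.
        f \<cdot>\<^bsub>C\<^esub> e = g \<cdot>\<^bsub>C\<^esub> e \<longrightarrow> f = g)"

definition isomorphic :: "('o, 'm) category \<Rightarrow> 'o \<Rightarrow> 'o \<Rightarrow> bool" where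
  "isomorphic C X Y \<longleftrightarrow> X \<in> Obj C \<and> Y \<in> Obj C \<and>
     (\<exists>f \<in> hom C X Y. \<exists>g \<in> hom C Y X. g \<cdot>\<^bsub>C\<^esub> f = Id C X \<and> f \<cdot>\<^bsub>C\<^esub> g = Id C Y)"

definition has_epi_mono_factorisations :: "('o, 'm) category \<Rightarrow> bool" where
  "has_epi_mono_factorisations C \<longleftrightarrow>
     (\<forall>f \<in> Arr C. \<exists>m e. monic C m \<and> epic C e \<and> Cod C e = Dom C m \<and> f = m \<cdot>\<^bsub>C\<^esub> e)"


section \<open>Pullbacks and pushouts\<close>

text \<open>In \<open>is_pullback C f g p q\<close> the square is \<open>f \<cdot> p = g \<cdot> q\<close>, so that \<open>p\<close> is the pullback of
  \<open>g\<close> along \<open>f\<close>.\<close>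

definition is_pullback :: "('o, 'm) category \<Rightarrow> 'm \<Rightarrow> 'm \<Rightarrow> 'm \<Rightarrow> 'm \<Rightarrow> bool" where
  "is_pullback C f g p q \<longleftrightarrow>
     f \<in> Arr C \<and> g \<in> Arr C \<and> p \<in> Arr C \<and> q \<in> Arr C \<and>
     Cod C f = Cod C g \<and> Dom C p = Dom C q \<and> Cod C p = Dom C f \<and> Cod C q = Dom C g \<and>
     f \<cdot>\<^bsub>C\<^esub> p = g \<cdot>\<^bsub>C\<^esub> q \<and>
     (\<forall>Y. \<forall>a \<in> hom C Y (Dom C f). \<forall>b \<in> hom C Y (Dom C g). f \<cdot>\<^bsub>C\<^esub> a = g \<cdot>\<^bsub>C\<^esub> b \<longrightarrow>
        (\<exists>!h. h \<in> hom C Y (Dom C p) \<and> p \<cdot>\<^bsub>C\<^esub> h = a \<and> q \<cdot>\<^bsub>C\<^esub> h = b))"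

text \<open>Dually, in \<open>is_pushout C f g i j\<close> the square is \<open>i \<cdot> f = j \<cdot> g\<close>, so that \<open>i\<close> is the pushout
  of \<open>g\<close> along \<open>f\<close>.\<close>

definition is_pushout :: "('o, 'm) category \<Rightarrow> 'm \<Rightarrow> 'm \<Rightarrow> 'm \<Rightarrow> 'm \<Rightarrow> bool" where
  "is_pushout C f g i j \<longleftrightarrow>
     f \<in> Arr C \<and> g \<in> Arr C \<and> i \<in> Arr C \<and> j \<in> Arr C \<and>
     Dom C f = Dom C g \<and> Cod C i = Cod C j \<and> Dom C i = Cod C f \<and> Dom C j = Cod C g \<and>
     i \<cdot>\<^bsub>C\<^esub> f = j \<cdot>\<^bsub>C\<^esub> g \<and>
     (\<forall>Y. \<forall>a \<in> hom C (Cod C f) Y. \<forall>b \<in> hom C (Cod C g) Y. a \<cdot>\<^bsub>C\<^esub> f = b \<cdot>\<^bsub>C\<^esub> g \<longrightarrow>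
        (\<exists>!h. h \<in> hom C (Cod C i) Y \<and> h \<cdot>\<^bsub>C\<^esub> i = a \<and> h \<cdot>\<^bsub>C\<^esub> j = b))"

definition has_pullbacks :: "('o, 'm) category \<Rightarrow> bool" where
  "has_pullbacks C \<longleftrightarrow>
     (\<forall>f \<in> Arr C. \<forall>g \<in> Arr C. Cod C f = Cod C g \<longrightarrow> (\<exists>p q. is_pullback C f g p q))"

definition has_pushouts :: "('o, 'm) category \<Rightarrow> bool" where
  "has_pushouts C \<longleftrightarrow>
     (\<forall>f \<in> Arr C. \<forall>g \<in> Arr C. Dom C f = Dom C g \<longrightarrow> (\<exists>i j. is_pushout C f g i j))"


section \<open>Pointed categories, kernels and short exact sequences\<close>

definition zero_object :: "('o, 'm) category \<Rightarrow> 'o \<Rightarrow> bool" where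
  "zero_object C Z \<longleftrightarrow> Z \<in> Obj C \<and>
     (\<forall>X \<in> Obj C. \<exists>!f. f \<in> hom C X Z) \<and> (\<forall>X \<in> Obj C. \<exists>!f. f \<in> hom C Z X)"

definition pointed_category :: "('o, 'm) category \<Rightarrow> bool" where
  "pointed_category C \<longleftrightarrow> category C \<and> (\<exists>Z. zero_object C Z)"

definition zero_morphism :: "('o, 'm) category \<Rightarrow> 'm \<Rightarrow> bool" where
  "zero_morphism C f \<longleftrightarrow> f \<in> Arr C \<and>
     (\<exists>Z. zero_object C Z \<and>
        (\<exists>a \<in> hom C (Dom C f) Z. \<exists>b \<in> hom C Z (Cod C f). f = b \<cdot>\<^bsub>C\<^esub> a))"

definition is_kernel :: "('o, 'm) category \<Rightarrow> 'm \<Rightarrow> 'm \<Rightarrow> bool" where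
  "is_kernel C k f \<longleftrightarrow> k \<in> Arr C \<and> f \<in> Arr C \<and> Cod C k = Dom C f \<and> zero_morphism C (f \<cdot>\<^bsub>C\<^esub> k) \<and>
     (\<forall>Y. \<forall>l \<in> hom C Y (Dom C f). zero_morphism C (f \<cdot>\<^bsub>C\<^esub> l) \<longrightarrow>
        (\<exists>!l'. l' \<in> hom C Y (Dom C k) \<and> l = k \<cdot>\<^bsub>C\<^esub> l'))"

definition is_cokernel :: "('o, 'm) category \<Rightarrow> 'm \<Rightarrow> 'm \<Rightarrow> bool" where
  "is_cokernel C q f \<longleftrightarrow> q \<in> Arr C \<and> f \<in> Arr C \<and> Dom C q = Cod C f \<and> zero_morphism C (q \<cdot>\<^bsub>C\<^esub> f) \<and>
     (\<forall>Y. \<forall>l \<in> hom C (Cod C f) Y. zero_morphism C (l \<cdot>\<^bsub>C\<^esub> f) \<longrightarrow>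
        (\<exists>!l'. l' \<in> hom C (Cod C q) Y \<and> l = l' \<cdot>\<^bsub>C\<^esub> q))"

definition short_exact :: "('o, 'm) category \<Rightarrow> 'm \<Rightarrow> 'm \<Rightarrow> bool" where
  "short_exact C f g \<longleftrightarrow> is_kernel C f g \<and> is_cokernel C g f"

definition normal_mono :: "('o, 'm) category \<Rightarrow> 'm \<Rightarrow> bool" where
  "normal_mono C k \<longleftrightarrow> (\<exists>f. is_kernel C k f)"

definition normal_epi :: "('o, 'm) category \<Rightarrow> 'm \<Rightarrow> bool" where
  "normal_epi C q \<longleftrightarrow> (\<exists>f. is_cokernel C q f)"

definition pullbacks_preserve_normal_epis :: "('o, 'm) category \<Rightarrow> bool" where
  "pullbacks_preserve_normal_epis C \<longleftrightarrow>
     (\<forall>f g p q. is_pullback C f g p q \<and> normal_epi C g \<longrightarrow> normal_epi C p)"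

definition pushouts_preserve_normal_monos :: "('o, 'm) category \<Rightarrow> bool" where
  "pushouts_preserve_normal_monos C \<longleftrightarrow>
     (\<forall>f g i j. is_pushout C f g i j \<and> normal_mono C g \<longrightarrow> normal_mono C i)"


section \<open>Functors and adjunctions\<close>

record ('o, 'm, 'p, 'n) functor_data =
  ObjMap :: "'o \<Rightarrow> 'p"
  ArrMap :: "'m \<Rightarrow> 'n"

definition is_functor ::
  "('o, 'm) category \<Rightarrow> ('p, 'n) category \<Rightarrow> ('o, 'm, 'p, 'n) functor_data \<Rightarrow> bool" where
  "is_functor C D F \<longleftrightarrow>
     (\<forall>X \<in> Obj C. ObjMap F X \<in> Obj D) \<and>
     (\<forall>f \<in> Arr C. ArrMap F f \<in> hom D (ObjMap F (Dom C f)) (ObjMap F (Cod C f))) \<and>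
     (\<forall>X \<in> Obj C. ArrMap F (Id C X) = Id D (ObjMap F X)) \<and>
     (\<forall>f \<in> Arr C. \<forall>g \<in> Arr C. Cod C f = Dom C g \<longrightarrow>
        ArrMap F (g \<cdot>\<^bsub>C\<^esub> f) = ArrMap F g \<cdot>\<^bsub>D\<^esub> ArrMap F f)"

text \<open>Identical on objects and arrows: this serves both as the identity functor of a category and as
  the inclusion of a subcategory.\<close>

definition incl_functor :: "('o, 'm, 'o, 'm) functor_data" where
  "incl_functor = \<lparr>ObjMap = (\<lambda>X. X), ArrMap = (\<lambda>f. f)\<rparr>"

definition comp_functor ::
  "('p, 'n, 'q, 'k) functor_data \<Rightarrow> ('o, 'm, 'p, 'n) functor_data \<Rightarrow> ('o, 'm, 'q, 'k) functor_data" where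
  "comp_functor G F = \<lparr>ObjMap = ObjMap G \<circ> ObjMap F, ArrMap = ArrMap G \<circ> ArrMap F\<rparr>"

definition natural_transformation ::
  "('o, 'm) category \<Rightarrow> ('p, 'n) category \<Rightarrow> ('o, 'm, 'p, 'n) functor_data \<Rightarrow>
   ('o, 'm, 'p, 'n) functor_data \<Rightarrow> ('o \<Rightarrow> 'n) \<Rightarrow> bool" where
  "natural_transformation C D F G \<tau> \<longleftrightarrow>
     is_functor C D F \<and> is_functor C D G \<and>
     (\<forall>X \<in> Obj C. \<tau> X \<in> hom D (ObjMap F X) (ObjMap G X)) \<and>
     (\<forall>f \<in> Arr C. \<tau> (Cod C f) \<cdot>\<^bsub>D\<^esub> ArrMap F f = ArrMap G f \<cdot>\<^bsub>D\<^esub> \<tau> (Dom C f))"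

text \<open>\<open>F : C \<rightarrow> D\<close> is left adjoint to \<open>G : D \<rightarrow> C\<close>, with unit \<open>\<eta>\<close> and counit \<open>\<epsilon>\<close>.\<close>

definition adjunction ::
  "('o, 'm) category \<Rightarrow> ('p, 'n) category \<Rightarrow> ('o, 'm, 'p, 'n) functor_data \<Rightarrow>
   ('p, 'n, 'o, 'm) functor_data \<Rightarrow> ('o \<Rightarrow> 'm) \<Rightarrow> ('p \<Rightarrow> 'n) \<Rightarrow> bool" where
  "adjunction C D F G \<eta> \<epsilon> \<longleftrightarrow>
     is_functor C D F \<and> is_functor D C G \<and>
     natural_transformation C C incl_functor (comp_functor G F) \<eta> \<and>
     natural_transformation D D (comp_functor F G) incl_functor \<epsilon> \<and>
     (\<forall>X \<in> Obj C. \<epsilon> (ObjMap F X) \<cdot>\<^bsub>D\<^esub> ArrMap F (\<eta> X) = Id D (ObjMap F X)) \<and>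
     (\<forall>Y \<in> Obj D. ArrMap G (\<epsilon> Y) \<cdot>\<^bsub>C\<^esub> \<eta> (ObjMap G Y) = Id C (ObjMap G Y))"


section \<open>Full subcategories\<close>

text \<open>A full subcategory is represented by its set of objects.\<close>

definition full_subcategory :: "('o, 'm) category \<Rightarrow> 'o set \<Rightarrow> ('o, 'm) category" where
  "full_subcategory C S =
     C\<lparr>Obj := Obj C \<inter> S, Arr := {f \<in> Arr C. Dom C f \<in> S \<and> Cod C f \<in> S}\<rparr>"

definition iso_closed :: "('o, 'm) category \<Rightarrow> 'o set \<Rightarrow> bool" where
  "iso_closed C S \<longleftrightarrow> (\<forall>X Y. X \<in> S \<and> isomorphic C X Y \<longrightarrow> Y \<in> S)"

definition torsion_theory :: "('o, 'm) category \<Rightarrow> 'o set \<Rightarrow> 'o set \<Rightarrow> bool" where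
  "torsion_theory C U V \<longleftrightarrow>
     U \<subseteq> Obj C \<and> V \<subseteq> Obj C \<and> iso_closed C U \<and> iso_closed C V \<and>
     (\<forall>X \<in> U. \<forall>Y \<in> V. \<forall>f \<in> hom C X Y. zero_morphism C f) \<and>
     (\<forall>X \<in> Obj C. \<exists>A \<in> U. \<exists>B \<in> V. \<exists>f \<in> hom C A X. \<exists>g \<in> hom C X B. short_exact C f g)"

definition serre_subcategory :: "('o, 'm) category \<Rightarrow> 'o set \<Rightarrow> bool" where
  "serre_subcategory C S \<longleftrightarrow>
     S \<subseteq> Obj C \<and>
     (\<forall>m. monic C m \<and> Cod C m \<in> S \<longrightarrow> Dom C m \<in> S) \<and>
     (\<forall>e. epic C e \<and> Dom C e \<in> S \<longrightarrow> Cod C e \<in> S) \<and>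
     (\<forall>A \<in> S. \<forall>B \<in> S. \<forall>X. \<forall>f \<in> hom C A X. \<forall>g \<in> hom C X B. short_exact C f g \<longrightarrow> X \<in> S)"

definition monocoreflective :: "('o, 'm) category \<Rightarrow> 'o set \<Rightarrow> bool" where
  "monocoreflective C S \<longleftrightarrow>
     (\<exists>R \<eta> \<epsilon>. adjunction (full_subcategory C S) C incl_functor R \<eta> \<epsilon> \<and>
        (\<forall>X \<in> Obj C. monic C (\<epsilon> X)))"

definition epireflective :: "('o, 'm) category \<Rightarrow> 'o set \<Rightarrow> bool" where
  "epireflective C S \<longleftrightarrow>
     (\<exists>L \<eta> \<epsilon>. adjunction C (full_subcategory C S) L incl_functor \<eta> \<epsilon> \<and>
        (\<forall>X \<in> Obj C. epic C (\<eta> X)))"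

definition extensions :: "('o, 'm) category \<Rightarrow> 'o set \<Rightarrow> 'o set \<Rightarrow> 'o set" where
  "extensions C \<A> \<B> =
     {X \<in> Obj C. \<exists>A \<in> \<A>. \<exists>B \<in> \<B>. \<exists>f \<in> hom C A X. \<exists>g \<in> hom C X B. short_exact C f g}"


section \<open>Pretorsion theories\<close>

definition Triv :: "('o, 'm) category \<Rightarrow> 'o set \<Rightarrow> 'o \<Rightarrow> 'o \<Rightarrow> 'm set" where
  "Triv C \<Z> X Y = {f \<in> hom C X Y. \<exists>Z \<in> \<Z>. \<exists>a \<in> hom C X Z. \<exists>b \<in> hom C Z Y. f = b \<cdot>\<^bsub>C\<^esub> a}"

definition is_Z_kernel :: "('o, 'm) category \<Rightarrow> 'o set \<Rightarrow> 'm \<Rightarrow> 'm \<Rightarrow> bool" where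
  "is_Z_kernel C \<Z> k f \<longleftrightarrow> k \<in> Arr C \<and> f \<in> Arr C \<and> Cod C k = Dom C f \<and>
     f \<cdot>\<^bsub>C\<^esub> k \<in> Triv C \<Z> (Dom C k) (Cod C f) \<and>
     (\<forall>Y. \<forall>l \<in> hom C Y (Dom C f). f \<cdot>\<^bsub>C\<^esub> l \<in> Triv C \<Z> Y (Cod C f) \<longrightarrow>
        (\<exists>!l'. l' \<in> hom C Y (Dom C k) \<and> l = k \<cdot>\<^bsub>C\<^esub> l'))"

definition is_Z_cokernel :: "('o, 'm) category \<Rightarrow> 'o set \<Rightarrow> 'm \<Rightarrow> 'm \<Rightarrow> bool" where
  "is_Z_cokernel C \<Z> q f \<longleftrightarrow> q \<in> Arr C \<and> f \<in> Arr C \<and> Dom C q = Cod C f \<and>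
     q \<cdot>\<^bsub>C\<^esub> f \<in> Triv C \<Z> (Dom C f) (Cod C q) \<and>
     (\<forall>Y. \<forall>l \<in> hom C (Cod C f) Y. l \<cdot>\<^bsub>C\<^esub> f \<in> Triv C \<Z> (Dom C f) Y \<longrightarrow>
        (\<exists>!l'. l' \<in> hom C (Cod C q) Y \<and> l = l' \<cdot>\<^bsub>C\<^esub> q))"

definition short_Z_exact :: "('o, 'm) category \<Rightarrow> 'o set \<Rightarrow> 'm \<Rightarrow> 'm \<Rightarrow> bool" where
  "short_Z_exact C \<Z> f g \<longleftrightarrow> is_Z_kernel C \<Z> f g \<and> is_Z_cokernel C \<Z> g f"

text \<open>The class of trivial objects is \<open>\<T> \<inter> \<F>\<close>.\<close>

definition pretorsion_theory :: "('o, 'm) category \<Rightarrow> 'o set \<Rightarrow> 'o set \<Rightarrow> bool" where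
  "pretorsion_theory C \<T> \<F> \<longleftrightarrow>
     \<T> \<subseteq> Obj C \<and> \<F> \<subseteq> Obj C \<and> iso_closed C \<T> \<and> iso_closed C \<F> \<and>
     (\<forall>X \<in> \<T>. \<forall>Y \<in> \<F>. hom C X Y = Triv C (\<T> \<inter> \<F>) X Y) \<and>
     (\<forall>X \<in> Obj C. \<exists>A \<in> \<T>. \<exists>B \<in> \<F>. \<exists>f \<in> hom C A X. \<exists>g \<in> hom C X B.
        short_Z_exact C (\<T> \<inter> \<F>) f g)"

end

theory Submission
  imports Defs
begin

text \<open>For a morphism from \<open>\<U> \<ast> \<S>\<close> to \<open>\<S> \<ast> \<V>\<close>, the kernel of the composite of its image with the
  quotient in \<open>\<V>\<close> is a subobject of an object of \<open>\<S>\<close>, and the cokernel of that kernel is a quotient of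
  an object of \<open>\<S>\<close>; so the image is an extension of objects of \<open>\<S>\<close>.

  Given \<open>0 \<rightarrow> U \<rightarrow> X \<rightarrow> V \<rightarrow> 0\<close>, the torsion part \<open>T \<rightarrow> X\<close> is the pullback along \<open>X \<rightarrow> V\<close> of the
  coreflection of \<open>V\<close> in \<open>\<S>\<close>, and the torsion-free part \<open>X \<rightarrow> F\<close> is the pushout along \<open>U \<rightarrow> X\<close> of the
  reflection of \<open>U\<close> in \<open>\<S>\<close>. A morphism \<open>Y \<rightarrow> X\<close> whose composite with \<open>X \<rightarrow> F\<close> factors through \<open>\<S>\<close>
  also has a composite with \<open>X \<rightarrow> F \<rightarrow> V\<close> that factors through \<open>\<S>\<close>, hence through the coreflection,
  and so it lifts to \<open>T\<close>. The dual argument shows that \<open>X \<rightarrow> F\<close> is a \<open>\<S>\<close>-cokernel.\<close>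

section \<open>The opposite category\<close>

text \<open>Objects, arrows and identities are kept and only \<open>Dom\<close>, \<open>Cod\<close>
  and the order of composition are exchanged. The simp rules below therefore turn each notion into
  its dual, and statements on cokernels and pushouts follow from those on kernels and
  pullbacks.\<close>

definition opposite :: "('o, 'm) category \<Rightarrow> ('o, 'm) category" where
  "opposite C = \<lparr>Obj = Obj C, Arr = Arr C, Dom = Cod C, Cod = Dom C, Id = Id C,
                 Comp = (\<lambda>g f. f \<cdot>\<^bsub>C\<^esub> g)\<rparr>"

lemma opposite_simps [simp]:
  "Obj (opposite C) = Obj C" "Arr (opposite C) = Arr C"
  "Dom (opposite C) = Cod C" "Cod (opposite C) = Dom C" "Id (opposite C) = Id C"
  "g \<cdot>\<^bsub>opposite C\<^esub> f = f \<cdot>\<^bsub>C\<^esub> g"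
  by (simp_all add: opposite_def)

lemma hom_opposite [simp]: "hom (opposite C) X Y = hom C Y X"
  by (auto simp: hom_def)

lemma monic_opposite [simp]: "monic (opposite C) f \<longleftrightarrow> epic C f"
  by (simp add: monic_def epic_def)

lemma zero_object_opposite [simp]: "zero_object (opposite C) Z \<longleftrightarrow> zero_object C Z"
  by (auto simp: zero_object_def)

lemma zero_morphism_opposite [simp]: "zero_morphism (opposite C) f \<longleftrightarrow> zero_morphism C f"
  by (auto simp: zero_morphism_def)

lemma is_kernel_opposite [simp]: "is_kernel (opposite C) k f \<longleftrightarrow> is_cokernel C k f"
  by (simp add: is_kernel_def is_cokernel_def)

lemma is_cokernel_opposite [simp]: "is_cokernel (opposite C) k f \<longleftrightarrow> is_kernel C k f"
  by (simp add: is_kernel_def is_cokernel_def)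

lemma short_exact_opposite [simp]: "short_exact (opposite C) f g \<longleftrightarrow> short_exact C g f"
  by (auto simp: short_exact_def)

lemma normal_epi_opposite [simp]: "normal_epi (opposite C) f \<longleftrightarrow> normal_mono C f"
  by (simp add: normal_epi_def normal_mono_def)

lemma is_pullback_opposite [simp]: "is_pullback (opposite C) f g p q \<longleftrightarrow> is_pushout C f g p q"
  by (simp add: is_pullback_def is_pushout_def)

lemma has_pullbacks_opposite [simp]: "has_pullbacks (opposite C) \<longleftrightarrow> has_pushouts C"
  by (simp add: has_pullbacks_def has_pushouts_def)

lemma pullbacks_preserve_normal_epis_opposite [simp]:
  "pullbacks_preserve_normal_epis (opposite C) \<longleftrightarrow> pushouts_preserve_normal_monos C"
  by (simp add: pullbacks_preserve_normal_epis_def pushouts_preserve_normal_monos_def)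

lemma (in category) category_opposite: "category (opposite C)"
proof
  fix f X Y g Z
  assume "f \<in> hom (opposite C) X Y" "g \<in> hom (opposite C) Y Z"
  then show "g \<cdot>\<^bsub>opposite C\<^esub> f \<in> hom (opposite C) X Z"
    using comp_hom by simp
next
  fix f W X g Y h Z
  assume "f \<in> hom (opposite C) W X" "g \<in> hom (opposite C) X Y" "h \<in> hom (opposite C) Y Z"
  then show "(h \<cdot>\<^bsub>opposite C\<^esub> g) \<cdot>\<^bsub>opposite C\<^esub> f = h \<cdot>\<^bsub>opposite C\<^esub> (g \<cdot>\<^bsub>opposite C\<^esub> f)"
    using comp_assoc by simp
qed (simp_all add: dom_obj cod_obj id_hom comp_id_left comp_id_right)


section \<open>Kernels and pullbacks in pointed categories\<close>

lemma monicD: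
  "\<lbrakk>monic C m; m \<in> hom C M X; f \<in> hom C Y M; g \<in> hom C Y M; m \<cdot>\<^bsub>C\<^esub> f = m \<cdot>\<^bsub>C\<^esub> g\<rbrakk> \<Longrightarrow> f = g"
  unfolding monic_def hom_def by blast

lemma epicD:
  "\<lbrakk>epic C e; e \<in> hom C X E; f \<in> hom C E Y; g \<in> hom C E Y; f \<cdot>\<^bsub>C\<^esub> e = g \<cdot>\<^bsub>C\<^esub> e\<rbrakk> \<Longrightarrow> f = g"
  unfolding epic_def hom_def by blast

lemma monicI:
  "\<lbrakk>m \<in> hom C M X; \<And>Y f g. \<lbrakk>f \<in> hom C Y M; g \<in> hom C Y M; m \<cdot>\<^bsub>C\<^esub> f = m \<cdot>\<^bsub>C\<^esub> g\<rbrakk> \<Longrightarrow> f = g\<rbrakk>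
    \<Longrightarrow> monic C m"
  unfolding monic_def hom_def by blast

lemma epicI:
  "\<lbrakk>e \<in> hom C X E; \<And>Y f g. \<lbrakk>f \<in> hom C E Y; g \<in> hom C E Y; f \<cdot>\<^bsub>C\<^esub> e = g \<cdot>\<^bsub>C\<^esub> e\<rbrakk> \<Longrightarrow> f = g\<rbrakk>
    \<Longrightarrow> epic C e"
  unfolding epic_def hom_def by blast

text \<open>Monicity of \<open>k\<close> supplies the uniqueness of factorisations, so only their
  existence has to be checked.\<close>

lemma is_kernelI:
  assumes "k \<in> hom C K X" "f \<in> hom C X Y" "zero_morphism C (f \<cdot>\<^bsub>C\<^esub> k)" "monic C k"
    and "\<And>W l. \<lbrakk>l \<in> hom C W X; zero_morphism C (f \<cdot>\<^bsub>C\<^esub> l)\<rbrakk> \<Longrightarrow> \<exists>l' \<in> hom C W K. l = k \<cdot>\<^bsub>C\<^esub> l'"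
  shows "is_kernel C k f"
proof -
  have "\<exists>!l'. l' \<in> hom C W K \<and> l = k \<cdot>\<^bsub>C\<^esub> l'"
    if "l \<in> hom C W X" "zero_morphism C (f \<cdot>\<^bsub>C\<^esub> l)" for W l
    using assms(5)[OF that] monicD[OF assms(4,1)] by metis
  then show ?thesis
    using assms(1-3) unfolding is_kernel_def by (auto simp: hom_def)
qed

lemma is_kernel_zero: "is_kernel C k f \<Longrightarrow> zero_morphism C (f \<cdot>\<^bsub>C\<^esub> k)"
  by (simp add: is_kernel_def)

lemma is_cokernel_zero: "is_cokernel C q f \<Longrightarrow> zero_morphism C (q \<cdot>\<^bsub>C\<^esub> f)"
  by (simp add: is_cokernel_def)

lemma is_kernel_ex:
  "\<lbrakk>is_kernel C k f; k \<in> hom C K X; l \<in> hom C W X; zero_morphism C (f \<cdot>\<^bsub>C\<^esub> l)\<rbrakk>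
    \<Longrightarrow> \<exists>l' \<in> hom C W K. l = k \<cdot>\<^bsub>C\<^esub> l'"
  unfolding is_kernel_def by (simp add: hom_def) metis

lemma is_cokernel_ex:
  "\<lbrakk>is_cokernel C q f; q \<in> hom C X Q; l \<in> hom C X W; zero_morphism C (l \<cdot>\<^bsub>C\<^esub> f)\<rbrakk>
    \<Longrightarrow> \<exists>l' \<in> hom C Q W. l = l' \<cdot>\<^bsub>C\<^esub> q"
  using is_kernel_ex[of "opposite C" q f Q X l W] by simp

lemma is_pullback_ex:
  "\<lbrakk>is_pullback C f g p q; p \<in> hom C P A; q \<in> hom C P B; a \<in> hom C Y A; b \<in> hom C Y B;
    f \<cdot>\<^bsub>C\<^esub> a = g \<cdot>\<^bsub>C\<^esub> b\<rbrakk> \<Longrightarrow> \<exists>h \<in> hom C Y P. p \<cdot>\<^bsub>C\<^esub> h = a \<and> q \<cdot>\<^bsub>C\<^esub> h = b"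
  unfolding is_pullback_def by (simp add: hom_def) metis

lemma has_pullbacks_ex:
  assumes "has_pullbacks C" "f \<in> hom C A D" "g \<in> hom C B D"
  obtains P p q where "is_pullback C f g p q" "p \<in> hom C P A" "q \<in> hom C P B"
    "f \<cdot>\<^bsub>C\<^esub> p = g \<cdot>\<^bsub>C\<^esub> q"
proof -
  have "f \<in> Arr C" "g \<in> Arr C" "Cod C f = Cod C g" using assms(2,3) by (auto simp: hom_def)
  then obtain p q where P: "is_pullback C f g p q"
    using assms(1) unfolding has_pullbacks_def by metis
  then have "p \<in> hom C (Dom C p) A" "q \<in> hom C (Dom C p) B" "f \<cdot>\<^bsub>C\<^esub> p = g \<cdot>\<^bsub>C\<^esub> q"
    using assms(2,3) unfolding is_pullback_def by (simp_all add: hom_def)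
  then show ?thesis using that[OF P] by blast
qed

lemma is_pullback_sym: "is_pullback C f g p q \<Longrightarrow> is_pullback C g f q p"
  unfolding is_pullback_def by (simp add: conj_commute) metis

section \<open>Closure properties of Serre subcategories\<close>

lemma serre_subobject:
  assumes "serre_subcategory C S" "monic C m" "m \<in> hom C A X" "X \<in> S"
  shows "A \<in> S"
proof -
  have "Cod C m \<in> S" and A: "Dom C m = A" using assms(3,4) by (simp_all add: hom_def)
  then show ?thesis using assms(1,2) unfolding serre_subcategory_def A[symmetric] by blast
qed

lemma serre_quotient:
  assumes "serre_subcategory C S" "epic C e" "e \<in> hom C X B" "X \<in> S"
  shows "B \<in> S"
proof -
  have "Dom C e \<in> S" and B: "Cod C e = B" using assms(3,4) by (simp_all add: hom_def)
  then show ?thesis using assms(1,2) unfolding serre_subcategory_def B[symmetric] by blast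
qed

lemma serre_extension:
  "\<lbrakk>serre_subcategory C S; short_exact C f g; f \<in> hom C A X; g \<in> hom C X B; A \<in> S; B \<in> S\<rbrakk>
    \<Longrightarrow> X \<in> S"
  unfolding serre_subcategory_def by blast

locale pointed = category +
  assumes ex_zero_object: "\<exists>Z. zero_object C Z"
begin

lemma pointed_opposite: "pointed (opposite C)"
  by (simp add: pointed_def pointed_axioms_def category_opposite ex_zero_object)

lemma assoc: "\<lbrakk>f \<in> hom C W X; g \<in> hom C X Y; h \<in> hom C Y Z\<rbrakk> \<Longrightarrow> (h \<cdot> g) \<cdot> f = h \<cdot> (g \<cdot> f)"
  by (rule comp_assoc)

text \<open>The projections of a pullback are jointly monic: both \<open>h\<close> and
  \<open>h'\<close> are the mediating morphism of the cone with legs \<open>p \<cdot> h\<close> and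
  \<open>q \<cdot> h\<close>.\<close>

lemma is_pullback_unique:
  assumes P: "is_pullback C f g p q"
    and pq: "f \<in> hom C A D" "g \<in> hom C B D" "p \<in> hom C P A" "q \<in> hom C P B" "f \<cdot> p = g \<cdot> q"
    and h: "h \<in> hom C Y P" "h' \<in> hom C Y P" "p \<cdot> h = p \<cdot> h'" "q \<cdot> h = q \<cdot> h'"
  shows "h = h'"
proof -
  have dom: "Dom C f = A" "Dom C g = B" "Dom C p = P" using pq by (auto simp: hom_def)
  have "f \<cdot> (p \<cdot> h) = g \<cdot> (q \<cdot> h)"
    using assoc[OF h(1) pq(3,1)] assoc[OF h(1) pq(4,2)] pq(5) by simp
  moreover have "p \<cdot> h \<in> hom C Y A" "q \<cdot> h \<in> hom C Y B"
    using comp_hom[OF h(1) pq(3)] comp_hom[OF h(1) pq(4)] by simp_all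
  ultimately have "\<exists>!k. k \<in> hom C Y P \<and> p \<cdot> k = p \<cdot> h \<and> q \<cdot> k = q \<cdot> h"
    using P unfolding is_pullback_def dom by blast
  then show ?thesis using h by metis
qed

lemma id_right: "f \<in> hom C X Y \<Longrightarrow> f \<cdot> Id C X = f"
  using comp_id_right by (auto simp: hom_def)

lemma id_left: "f \<in> hom C X Y \<Longrightarrow> Id C Y \<cdot> f = f"
  using comp_id_left by (auto simp: hom_def)

lemma hom_objs: "f \<in> hom C X Y \<Longrightarrow> X \<in> Obj C \<and> Y \<in> Obj C"
  using dom_obj cod_obj by (auto simp: hom_def)

section \<open>Zero objects and zero morphisms\<close>

lemma zero_object_from_unique: "\<lbrakk>zero_object C Z; a \<in> hom C Z X; b \<in> hom C Z X\<rbrakk> \<Longrightarrow> a = b"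
  using hom_objs[of a Z X] unfolding zero_object_def by blast

lemma zero_object_to_unique: "\<lbrakk>zero_object C Z; a \<in> hom C X Z; b \<in> hom C X Z\<rbrakk> \<Longrightarrow> a = b"
  using hom_objs[of a X Z] unfolding zero_object_def by blast

lemma zero_object_from_ex: "\<lbrakk>zero_object C Z; X \<in> Obj C\<rbrakk> \<Longrightarrow> \<exists>a. a \<in> hom C Z X"
  unfolding zero_object_def by blast

lemma zero_object_to_ex: "\<lbrakk>zero_object C Z; X \<in> Obj C\<rbrakk> \<Longrightarrow> \<exists>a. a \<in> hom C X Z"
  unfolding zero_object_def by blast

text \<open>The zero object in the definition of a zero morphism may be replaced by any prescribed
  one: the factorisation through \<open>Z'\<close> is rerouted along \<open>i\<close> and
  \<open>j\<close>, which compose to the identity of \<open>Z'\<close> because morphisms out of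
  \<open>Z'\<close> are unique.\<close>

lemma zero_morphismE:
  assumes "zero_morphism C f" "f \<in> hom C X Y" "zero_object C Z"
  obtains a b where "a \<in> hom C X Z" "b \<in> hom C Z Y" "f = b \<cdot> a"
proof -
  obtain Z' a b where z': "zero_object C Z'" and ab: "a \<in> hom C X Z'" "b \<in> hom C Z' Y" "f = b \<cdot> a"
    using assms unfolding zero_morphism_def hom_def by blast
  have Z': "Z' \<in> Obj C" using z' by (simp add: zero_object_def)
  obtain i j where ij: "i \<in> hom C Z' Z" "j \<in> hom C Z Z'"
    using zero_object_to_ex[OF assms(3) Z'] zero_object_from_ex[OF assms(3) Z'] by blast
  have "j \<cdot> i = Id C Z'"
    by (rule zero_object_from_unique[OF z' comp_hom[OF ij] id_hom[OF Z']])
  then have "f = (b \<cdot> j) \<cdot> (i \<cdot> a)"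
    using assoc[OF comp_hom[OF ab(1) ij(1)] ij(2) ab(2)] assoc[OF ab(1) ij] id_left[OF ab(1)] ab(3)
    by simp
  then show ?thesis
    using that[OF comp_hom[OF ab(1) ij(1)] comp_hom[OF ij(2) ab(2)]] by blast
qed

lemma zero_morphismI:
  "\<lbrakk>zero_object C Z; a \<in> hom C X Z; b \<in> hom C Z Y\<rbrakk> \<Longrightarrow> zero_morphism C (b \<cdot> a)"
  using comp_hom[of a X Z b Y] unfolding zero_morphism_def by (auto simp: hom_def)

text \<open>Once both morphisms factor through the same zero object, their factors coincide. Later
  equations between composites that vanish are obtained in this way.\<close>

lemma zero_morphism_unique:
  assumes "zero_morphism C f" "zero_morphism C g" "f \<in> hom C X Y" "g \<in> hom C X Y"
  shows "f = g"
proof -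
  obtain Z where Z: "zero_object C Z" using ex_zero_object by blast
  obtain a b where ab: "a \<in> hom C X Z" "b \<in> hom C Z Y" "f = b \<cdot> a"
    using zero_morphismE[OF assms(1,3) Z] .
  obtain a' b' where ab': "a' \<in> hom C X Z" "b' \<in> hom C Z Y" "g = b' \<cdot> a'"
    using zero_morphismE[OF assms(2,4) Z] .
  show ?thesis
    using ab(3) ab'(3) zero_object_to_unique[OF Z ab(1) ab'(1)] zero_object_from_unique[OF Z ab(2) ab'(2)]
    by simp
qed

lemma zero_morphism_ex:
  assumes "X \<in> Obj C" "Y \<in> Obj C"
  shows "\<exists>f \<in> hom C X Y. zero_morphism C f"
proof -
  obtain Z where Z: "zero_object C Z" using ex_zero_object by blast
  obtain a b where "a \<in> hom C X Z" "b \<in> hom C Z Y"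
    using zero_object_to_ex[OF Z assms(1)] zero_object_from_ex[OF Z assms(2)] by blast
  then show ?thesis using comp_hom zero_morphismI[OF Z] by blast
qed

lemma zero_morphism_comp_left:
  assumes "zero_morphism C f" "f \<in> hom C X Y" "g \<in> hom C Y W"
  shows "zero_morphism C (g \<cdot> f)"
proof -
  obtain Z where Z: "zero_object C Z" using ex_zero_object by blast
  obtain a b where ab: "a \<in> hom C X Z" "b \<in> hom C Z Y" "f = b \<cdot> a"
    using zero_morphismE[OF assms(1,2) Z] .
  then show ?thesis
    using zero_morphismI[OF Z ab(1) comp_hom[OF ab(2) assms(3)]] assoc[OF ab(1,2) assms(3)] by simp
qed

lemma zero_morphism_comp_right:
  assumes "zero_morphism C f" "f \<in> hom C X Y" "g \<in> hom C W X"
  shows "zero_morphism C (f \<cdot> g)"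
  using pointed.zero_morphism_comp_left[OF pointed_opposite, of f Y X g W] assms by simp

section \<open>Kernels and cokernels\<close>

lemma is_kernel_monic:
  assumes k: "is_kernel C k f"
  shows "monic C k"
proof -
  obtain K X Y where h: "k \<in> hom C K X" "f \<in> hom C X Y"
    using k unfolding is_kernel_def hom_def by auto
  show ?thesis
  proof (rule monicI[OF h(1)])
    fix W a b assume ab: "a \<in> hom C W K" "b \<in> hom C W K" "k \<cdot> a = k \<cdot> b"
    \<comment> \<open>Both \<open>a\<close> and \<open>b\<close> lift the morphism
      \<open>k \<cdot> a\<close>, which \<open>f\<close> kills, so the uniqueness clause of the
      kernel identifies them.\<close>
    have "zero_morphism C (f \<cdot> (k \<cdot> a))"
      using zero_morphism_comp_right[OF is_kernel_zero[OF k] comp_hom[OF h] ab(1)] assoc[OF ab(1) h]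
      by simp
    moreover have "k \<cdot> a \<in> hom C W (Dom C f)" using comp_hom[OF ab(1) h(1)] h(2) by (simp add: hom_def)
    ultimately have "\<exists>!l. l \<in> hom C W (Dom C k) \<and> k \<cdot> a = k \<cdot> l"
      using k unfolding is_kernel_def by blast
    moreover have "Dom C k = K" using h(1) by (simp add: hom_def)
    ultimately show "a = b" using ab by blast
  qed
qed

lemma is_cokernel_epic: "is_cokernel C q f \<Longrightarrow> epic C q"
  using pointed.is_kernel_monic[OF pointed_opposite] by simp

text \<open>Since \<open>f\<close> factors through \<open>k\<close>, a morphism that kills
  \<open>k\<close> also kills \<open>f\<close> and hence factors through \<open>q\<close>. This
  completes a normal epimorphism with a known kernel to a short exact sequence.\<close>

lemma cokernel_of_kernel:
  assumes q: "is_cokernel C q f" and k: "is_kernel C k q"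
  shows "is_cokernel C q k"
proof -
  obtain A X Q where h: "f \<in> hom C A X" "q \<in> hom C X Q"
    using q unfolding is_cokernel_def hom_def by auto
  obtain K where hk: "k \<in> hom C K X" using k h unfolding is_kernel_def hom_def by auto
  obtain f' where f': "f' \<in> hom C A K" "f = k \<cdot> f'"
    using is_kernel_ex[OF k hk h(1) is_cokernel_zero[OF q]] by blast
  have "is_kernel (opposite C) q k"
  proof (rule is_kernelI)
    fix W l assume l: "l \<in> hom (opposite C) W X" "zero_morphism (opposite C) (k \<cdot>\<^bsub>opposite C\<^esub> l)"
    then have l': "l \<in> hom C X W" "zero_morphism C (l \<cdot> k)" by auto
    then have "zero_morphism C (l \<cdot> f)"
      using zero_morphism_comp_right[OF l'(2) comp_hom[OF hk l'(1)] f'(1)] f'(2) assoc[OF f'(1) hk l'(1)] by simp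
    then show "\<exists>l' \<in> hom (opposite C) W Q. l = q \<cdot>\<^bsub>opposite C\<^esub> l'"
      using is_cokernel_ex[OF q h(2) l'(1)] by simp
  qed (use h hk is_kernel_zero[OF k] is_cokernel_epic[OF q] in auto)
  then show ?thesis by simp
qed

lemma kernel_of_cokernel:
  assumes "is_kernel C k f" and "is_cokernel C q k"
  shows "is_kernel C k q"
  using pointed.cokernel_of_kernel[OF pointed_opposite, of k f q] assms by simp

text \<open>The cokernel of \<open>f\<close> is its pushout along the morphism from \<open>A\<close>
  to a zero object, here read as a pullback in the opposite category.\<close>

lemma cokernel_ex:
  assumes po: "has_pushouts C" and f: "f \<in> hom C A X"
  shows "\<exists>Q. \<exists>q \<in> hom C X Q. is_cokernel C q f"
proof -
  obtain Z where Z: "zero_object C Z" using ex_zero_object by blast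
  obtain z where z: "z \<in> hom C A Z"
    using zero_object_to_ex[OF Z] hom_objs[OF f] by blast
  obtain Q q w where P: "is_pullback (opposite C) f z q w"
    and h: "q \<in> hom C X Q" "w \<in> hom C Z Q" "q \<cdot> f = w \<cdot> z"
    using has_pullbacks_ex[of "opposite C" f X A z Z thesis] po f z by simp
  have "is_kernel (opposite C) q f"
  proof (rule is_kernelI)
    show "monic (opposite C) q"
    proof (rule monicI)
      fix Y a b
      assume "a \<in> hom (opposite C) Y Q" "b \<in> hom (opposite C) Y Q"
        and eq: "q \<cdot>\<^bsub>opposite C\<^esub> a = q \<cdot>\<^bsub>opposite C\<^esub> b"
      then have ab: "a \<in> hom C Q Y" "b \<in> hom C Q Y" by auto
      \<comment> \<open>The leg \<open>w\<close> starts at the zero object, so the other leg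
        \<open>q\<close> alone already separates morphisms out of \<open>Q\<close>.\<close>
      have "a \<cdot> w = b \<cdot> w"
        by (rule zero_object_from_unique[OF Z comp_hom[OF h(2) ab(1)] comp_hom[OF h(2) ab(2)]])
      then show "a = b"
        using pointed.is_pullback_unique[OF pointed_opposite P, of X A Z Q a Y b] eq ab h f z by simp
    qed (use h in simp)
  next
    fix W l assume "l \<in> hom (opposite C) W X" "zero_morphism (opposite C) (f \<cdot>\<^bsub>opposite C\<^esub> l)"
    then have l: "l \<in> hom C X W" "zero_morphism C (l \<cdot> f)" by auto
    obtain u where u: "u \<in> hom C Z W"
      using zero_object_from_ex[OF Z] hom_objs[OF l(1)] by blast
    \<comment> \<open>Both sides are the zero morphism from \<open>A\<close> to \<open>W\<close>, so
      \<open>l\<close> and \<open>u\<close> form a cocone under the pushout square.\<close>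
    have "l \<cdot> f = u \<cdot> z"
      using zero_morphism_unique[OF l(2) zero_morphismI[OF Z z u] comp_hom[OF f l(1)] comp_hom[OF z u]] .
    then show "\<exists>l' \<in> hom (opposite C) W Q. l = q \<cdot>\<^bsub>opposite C\<^esub> l'"
      using is_pullback_ex[OF P, of Q X Z l W u] h l u by auto
  qed (use h f zero_morphismI[OF Z z h(2)] in auto)
  then show ?thesis using h by auto
qed

section \<open>Pulling back and pushing out short exact sequences\<close>

lemma pullback_monic:
  assumes P: "is_pullback C f g p q" and f: "monic C f"
  shows "monic C q"
proof -
  obtain A B D where h: "f \<in> hom C A D" "g \<in> hom C B D" "p \<in> hom C (Dom C p) A" "q \<in> hom C (Dom C p) B"
      "f \<cdot> p = g \<cdot> q"
    using P unfolding is_pullback_def hom_def by auto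
  show ?thesis
  proof (rule monicI[OF h(4)])
    fix Y a b assume ab: "a \<in> hom C Y (Dom C p)" "b \<in> hom C Y (Dom C p)" "q \<cdot> a = q \<cdot> b"
    \<comment> \<open>Agreement after \<open>q\<close> gives agreement after
      \<open>f \<cdot> p\<close>; cancelling \<open>f\<close> gives it after \<open>p\<close>, and
      the projections are jointly monic.\<close>
    have fg: "f \<cdot> (p \<cdot> a) = g \<cdot> (q \<cdot> a)" "f \<cdot> (p \<cdot> b) = g \<cdot> (q \<cdot> b)"
      using assoc[OF ab(1) h(3,1)] assoc[OF ab(1) h(4,2)] assoc[OF ab(2) h(3,1)] assoc[OF ab(2) h(4,2)] h(5)
      by simp_all
    then have "p \<cdot> a = p \<cdot> b"
      using monicD[OF f h(1) comp_hom[OF ab(1) h(3)] comp_hom[OF ab(2) h(3)]] ab(3) by simp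
    then show "a = b"
      using is_pullback_unique[OF P h ab(1,2)] ab(3) by simp
  qed
qed

text \<open>Pulling \<open>g\<close> back along a subobject of \<open>B\<close> yields a subobject
  \<open>T\<close> of \<open>X\<close> with the same kernel \<open>A\<close> and the quotient
  \<open>M\<close>. Stability of normal epimorphisms is what makes \<open>e\<close> a cokernel. The
  last clause keeps the universal property of the pullback, which later produces lifts to
  \<open>T\<close>.\<close>

lemma short_exact_pullback:
  assumes pb: "has_pullbacks C" "pullbacks_preserve_normal_epis C"
    and fg: "short_exact C f g" "f \<in> hom C A X" "g \<in> hom C X B"
    and m: "monic C m" "m \<in> hom C M B"
  obtains T t k e where "t \<in> hom C T X" "monic C t" "k \<in> hom C A T" "e \<in> hom C T M"
    "short_exact C k e" "t \<cdot> k = f"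
    "\<And>Y l b. \<lbrakk>l \<in> hom C Y X; b \<in> hom C Y M; g \<cdot> l = m \<cdot> b\<rbrakk> \<Longrightarrow> \<exists>h \<in> hom C Y T. l = t \<cdot> h"
proof -
  have kf: "is_kernel C f g" and cg: "is_cokernel C g f" using fg by (auto simp: short_exact_def)
  obtain T e t where P: "is_pullback C m g e t"
    and h: "t \<in> hom C T X" "e \<in> hom C T M" "m \<cdot> e = g \<cdot> t"
    using has_pullbacks_ex[OF pb(1) m(2) fg(3)] by metis
  have tm: "monic C t" by (rule pullback_monic[OF P m(1)])
  have "normal_epi C e"
    using pb(2) P cg unfolding pullbacks_preserve_normal_epis_def normal_epi_def by blast
  then obtain c where c: "is_cokernel C e c" unfolding normal_epi_def by blast
  obtain z where z: "z \<in> hom C A M" "zero_morphism C z"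
    using zero_morphism_ex hom_objs[OF fg(2)] hom_objs[OF m(2)] by blast
  \<comment> \<open>Both composites are the zero morphism from \<open>A\<close> to \<open>B\<close>,
    so \<open>z\<close> and \<open>f\<close> induce the inclusion \<open>k\<close> of
    \<open>A\<close> into the pullback.\<close>
  have "m \<cdot> z = g \<cdot> f"
    using zero_morphism_unique[OF zero_morphism_comp_left[OF z(2,1) m(2)] is_kernel_zero[OF kf]
        comp_hom[OF z(1) m(2)] comp_hom[OF fg(2,3)]] .
  then obtain k where k: "k \<in> hom C A T" "e \<cdot> k = z" "t \<cdot> k = f"
    using is_pullback_ex[OF P h(2,1) z(1) fg(2)] by blast
  have "is_kernel C k e"
  proof (rule is_kernelI)
    show "monic C k"
    proof (rule monicI[OF k(1)])
      fix Y a b assume ab: "a \<in> hom C Y A" "b \<in> hom C Y A" "k \<cdot> a = k \<cdot> b"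
      then have "f \<cdot> a = f \<cdot> b"
        using k(3) assoc[OF ab(1) k(1) h(1)] assoc[OF ab(2) k(1) h(1)] by simp
      then show "a = b" using monicD[OF is_kernel_monic[OF kf] fg(2)] ab by blast
    qed
  next
    fix W l assume l: "l \<in> hom C W T" "zero_morphism C (e \<cdot> l)"
    have "m \<cdot> (e \<cdot> l) = g \<cdot> (t \<cdot> l)"
      using assoc[OF l(1) h(2) m(2)] assoc[OF l(1) h(1) fg(3)] h(3) by simp
    then have "zero_morphism C (g \<cdot> (t \<cdot> l))"
      using zero_morphism_comp_left[OF l(2) comp_hom[OF l(1) h(2)] m(2)] by simp
    then obtain l' where l': "l' \<in> hom C W A" "t \<cdot> l = f \<cdot> l'"
      using is_kernel_ex[OF kf fg(2) comp_hom[OF l(1) h(1)]] by blast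
    then have "t \<cdot> l = t \<cdot> (k \<cdot> l')" using k(3) assoc[OF l'(1) k(1) h(1)] by simp
    then have "l = k \<cdot> l'" using monicD[OF tm h(1) l(1) comp_hom[OF l'(1) k(1)]] by simp
    then show "\<exists>l' \<in> hom C W A. l = k \<cdot> l'" using l' by blast
  qed (use k h z in auto)
  \<comment> \<open>Being a cokernel of some \<open>c\<close>, \<open>e\<close> is also the cokernel
    of its kernel \<open>k\<close>.\<close>
  then have "short_exact C k e"
    using cokernel_of_kernel[OF c] by (simp add: short_exact_def)
  moreover have "\<exists>h \<in> hom C Y T. l = t \<cdot> h"
    if "l \<in> hom C Y X" "b \<in> hom C Y M" "g \<cdot> l = m \<cdot> b" for Y l b
    using is_pullback_ex[OF P h(2,1) that(2,1)] that(3) by auto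
  ultimately show ?thesis using that h tm k by blast
qed

text \<open>Dual of \<open>short_exact_pullback\<close>: in the opposite category \<open>f\<close>
  and \<open>g\<close> trade places and the epimorphism \<open>n\<close> takes the role of
  \<open>m\<close>.\<close>

lemma short_exact_pushout:
  assumes "has_pushouts C" "pushouts_preserve_normal_monos C"
    and "short_exact C f g" "f \<in> hom C A X" "g \<in> hom C X B"
    and "epic C n" "n \<in> hom C A N"
  obtains F q d e where "q \<in> hom C X F" "epic C q" "d \<in> hom C N F" "e \<in> hom C F B"
    "short_exact C d e" "e \<cdot> q = g"
    "\<And>Y l b. \<lbrakk>l \<in> hom C X Y; b \<in> hom C N Y; l \<cdot> f = b \<cdot> n\<rbrakk> \<Longrightarrow> \<exists>h \<in> hom C F Y. l = h \<cdot> q"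
proof (rule pointed.short_exact_pullback[OF pointed_opposite, of g f B X A n N])
  fix F q e d
  assume h: "q \<in> hom (opposite C) F X" "monic (opposite C) q" "e \<in> hom (opposite C) B F"
    "d \<in> hom (opposite C) F N" "short_exact (opposite C) e d" "q \<cdot>\<^bsub>opposite C\<^esub> e = g"
    and lift: "\<And>Y l b. \<lbrakk>l \<in> hom (opposite C) Y X; b \<in> hom (opposite C) Y N;
      f \<cdot>\<^bsub>opposite C\<^esub> l = n \<cdot>\<^bsub>opposite C\<^esub> b\<rbrakk> \<Longrightarrow> \<exists>h \<in> hom (opposite C) Y F. l = q \<cdot>\<^bsub>opposite C\<^esub> h"
  have "\<exists>h \<in> hom C F Y. l = h \<cdot> q" if "l \<in> hom C X Y" "b \<in> hom C N Y" "l \<cdot> f = b \<cdot> n" for Y l b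
    using lift[of l Y b] that by simp
  then show thesis using that[of q F d e] h by simp
qed (use assms in simp_all)

section \<open>Invariance of extensions under isomorphism\<close>

lemma is_kernel_iso:
  assumes k: "is_kernel C k f" "k \<in> hom C K X" "f \<in> hom C X Y"
    and ij: "i \<in> hom C X X'" "j \<in> hom C X' X" "j \<cdot> i = Id C X" "i \<cdot> j = Id C X'"
  shows "is_kernel C (i \<cdot> k) (f \<cdot> j)"
proof (rule is_kernelI)
  have "(f \<cdot> j) \<cdot> (i \<cdot> k) = f \<cdot> ((j \<cdot> i) \<cdot> k)"
    using assoc[OF comp_hom[OF k(2) ij(1)] ij(2) k(3)] assoc[OF k(2) ij(1,2)] by simp
  then show "zero_morphism C ((f \<cdot> j) \<cdot> (i \<cdot> k))"
    using ij(3) id_left[OF k(2)] is_kernel_zero[OF k(1)] by simp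
  show hik: "i \<cdot> k \<in> hom C K X'" and "f \<cdot> j \<in> hom C X' Y"
    using comp_hom[OF k(2) ij(1)] comp_hom[OF ij(2) k(3)] by simp_all
  have ji: "j \<cdot> (i \<cdot> l) = l" if "l \<in> hom C W X" for W l
    using assoc[OF that ij(1,2)] id_left[OF that] ij(3) by metis
  have ij': "i \<cdot> (j \<cdot> l) = l" if "l \<in> hom C W X'" for W l
    using assoc[OF that ij(2,1)] id_left[OF that] ij(4) by metis
  show "monic C (i \<cdot> k)"
  proof (rule monicI[OF hik])
    fix W a b assume ab: "a \<in> hom C W K" "b \<in> hom C W K" "(i \<cdot> k) \<cdot> a = (i \<cdot> k) \<cdot> b"
    then have "i \<cdot> (k \<cdot> a) = i \<cdot> (k \<cdot> b)"
      using assoc[OF ab(1) k(2) ij(1)] assoc[OF ab(2) k(2) ij(1)] by simp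
    then have "k \<cdot> a = k \<cdot> b"
      using ji[OF comp_hom[OF ab(1) k(2)]] ji[OF comp_hom[OF ab(2) k(2)]] by metis
    then show "a = b" using monicD[OF is_kernel_monic[OF k(1)] k(2)] ab by blast
  qed
  fix W l assume l: "l \<in> hom C W X'" "zero_morphism C ((f \<cdot> j) \<cdot> l)"
  then have "zero_morphism C (f \<cdot> (j \<cdot> l))" using assoc[OF l(1) ij(2) k(3)] by simp
  then obtain l' where l': "l' \<in> hom C W K" "j \<cdot> l = k \<cdot> l'"
    using is_kernel_ex[OF k(1,2) comp_hom[OF l(1) ij(2)]] by blast
  then have "l = (i \<cdot> k) \<cdot> l'" using ij'[OF l(1)] assoc[OF l'(1) k(2) ij(1)] l'(2) by simp
  then show "\<exists>l' \<in> hom C W K. l = (i \<cdot> k) \<cdot> l'" using l' by blast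
qed

text \<open>Only the middle object of the sequence is transported and the outer objects stay the
  same, so \<open>\<A>\<close> and \<open>\<B>\<close> may be arbitrary.\<close>

lemma iso_closed_extensions: "iso_closed C (extensions C \<A> \<B>)"
  unfolding iso_closed_def
proof clarify
  fix X X' assume X: "X \<in> extensions C \<A> \<B>" and "isomorphic C X X'"
  then obtain i j where ij: "i \<in> hom C X X'" "j \<in> hom C X' X" "j \<cdot> i = Id C X" "i \<cdot> j = Id C X'"
    and X': "X' \<in> Obj C" unfolding isomorphic_def by blast
  obtain A B f g where fg: "A \<in> \<A>" "B \<in> \<B>" "f \<in> hom C A X" "g \<in> hom C X B"
      "is_kernel C f g" "is_cokernel C g f"
    using X unfolding extensions_def short_exact_def by blast
  have "is_kernel C (i \<cdot> f) (g \<cdot> j)" by (rule is_kernel_iso[OF fg(5,3,4) ij])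
  moreover have "is_cokernel C (g \<cdot> j) (i \<cdot> f)"
    using pointed.is_kernel_iso[OF pointed_opposite, of g f B X A j X' i] fg ij by simp
  ultimately show "X' \<in> extensions C \<A> \<B>"
    using fg(1,2) X' comp_hom[OF fg(3) ij(1)] comp_hom[OF ij(2) fg(4)]
    unfolding extensions_def short_exact_def by blast
qed


section \<open>Morphisms between extensions\<close>

text \<open>The witness for triviality is the image \<open>I\<close> of \<open>f\<close>, which is
  shown to lie in \<open>S\<close>. A torsion theory enters only through the vanishing of
  \<open>v \<cdot> (f \<cdot> a)\<close>, so none appears in the statement.\<close>

lemma Triv_between_extensions:
  assumes fact: "has_epi_mono_factorisations C" and pb: "has_pullbacks C" and po: "has_pushouts C"
    and S: "serre_subcategory C S"
    and ab: "short_exact C a b" "a \<in> hom C A X" "b \<in> hom C X B" "B \<in> S"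
    and sv: "short_exact C s v" "s \<in> hom C D Y" "v \<in> hom C Y V" "D \<in> S"
    and f: "f \<in> hom C X Y" and z: "zero_morphism C (v \<cdot> (f \<cdot> a))"
  shows "f \<in> Triv C S X Y"
proof -
  have ks: "is_kernel C s v" and cb: "is_cokernel C b a"
    using ab sv by (auto simp: short_exact_def)
  obtain m e where me: "monic C m" "epic C e" "Cod C e = Dom C m" "f = m \<cdot> e"
    using fact f unfolding has_epi_mono_factorisations_def hom_def by blast
  define I where "I = Dom C m"
  have arr: "e \<in> hom C (Dom C e) I" "m \<in> hom C I (Cod C m)"
    using me by (auto simp: I_def hom_def monic_def epic_def)
  then have "f \<in> hom C (Dom C e) (Cod C m)" using comp_hom me(4) by blast
  then have e: "e \<in> hom C X I" and m: "m \<in> hom C I Y" using arr f by (auto simp: hom_def)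
  \<comment> \<open>\<open>J\<close> is the intersection of the image \<open>I\<close> with the
    subobject \<open>D\<close> of \<open>Y\<close>.\<close>
  obtain J j d where P: "is_pullback C m s j d"
    and h: "j \<in> hom C J I" "d \<in> hom C J D" "m \<cdot> j = s \<cdot> d"
    using has_pullbacks_ex[OF pb m sv(2)] by metis
  \<comment> \<open>The square is flipped so that the kernel \<open>s\<close> is the monomorphism
    being pulled back.\<close>
  have jm: "monic C j"
    using pullback_monic[OF is_pullback_sym[OF P] is_kernel_monic[OF ks]] .
  have dm: "monic C d" using pullback_monic[OF P me(1)] .
  then have J: "J \<in> S" using serre_subobject[OF S _ h(2) sv(4)] by blast
  have vm: "v \<cdot> m \<in> hom C I V" by (rule comp_hom[OF m sv(3)])
  \<comment> \<open>A morphism into \<open>I\<close> is killed by \<open>v \<cdot> m\<close> exactly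
    when its composite with \<open>m\<close> factors through \<open>s\<close>, that is, when it
    factors through the pullback \<open>J\<close>.\<close>
  have kj: "is_kernel C j (v \<cdot> m)"
  proof (rule is_kernelI[OF h(1) vm _ jm])
    have "(v \<cdot> m) \<cdot> j = (v \<cdot> s) \<cdot> d"
      using assoc[OF h(1) m sv(3)] assoc[OF h(2) sv(2,3)] h(3) by simp
    then show "zero_morphism C ((v \<cdot> m) \<cdot> j)"
      using zero_morphism_comp_right[OF is_kernel_zero[OF ks] comp_hom[OF sv(2,3)] h(2)] by simp
  next
    fix W l assume l: "l \<in> hom C W I" "zero_morphism C ((v \<cdot> m) \<cdot> l)"
    then have "zero_morphism C (v \<cdot> (m \<cdot> l))" using assoc[OF l(1) m sv(3)] by simp
    then obtain l' where "l' \<in> hom C W D" "m \<cdot> l = s \<cdot> l'"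
      using is_kernel_ex[OF ks sv(2) comp_hom[OF l(1) m]] by blast
    then show "\<exists>l' \<in> hom C W J. l = j \<cdot> l'"
      using is_pullback_ex[OF P h(1,2) l(1)] by auto
  qed
  obtain Q c where c: "c \<in> hom C I Q" "is_cokernel C c j" using cokernel_ex[OF po h(1)] by blast
  \<comment> \<open>A kernel is the kernel of its own cokernel.\<close>
  have jc: "short_exact C j c" using kernel_of_cokernel[OF kj c(2)] c by (simp add: short_exact_def)
  have ea: "e \<cdot> a \<in> hom C A I" by (rule comp_hom[OF ab(2) e])
  \<comment> \<open>The vanishing hypothesis sends \<open>A\<close> into \<open>J\<close>; hence
    \<open>c \<cdot> e\<close> kills \<open>a\<close> and descends along \<open>b\<close> to a
    morphism \<open>q\<close> out of \<open>B\<close>.\<close>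
  have "zero_morphism C ((v \<cdot> m) \<cdot> (e \<cdot> a))"
    using z me(4) assoc[OF ab(2) e m] assoc[OF ea m sv(3)] by simp
  then obtain a' where a': "a' \<in> hom C A J" "e \<cdot> a = j \<cdot> a'"
    using is_kernel_ex[OF kj h(1) ea] by blast
  have ce: "c \<cdot> e \<in> hom C X Q" by (rule comp_hom[OF e c(1)])
  have "(c \<cdot> e) \<cdot> a = (c \<cdot> j) \<cdot> a'"
    using assoc[OF ab(2) e c(1)] assoc[OF a'(1) h(1) c(1)] a'(2) by simp
  then have "zero_morphism C ((c \<cdot> e) \<cdot> a)"
    using zero_morphism_comp_right[OF is_cokernel_zero[OF c(2)] comp_hom[OF h(1) c(1)] a'(1)] by simp
  then obtain q where q: "q \<in> hom C B Q" "c \<cdot> e = q \<cdot> b"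
    using is_cokernel_ex[OF cb ab(3) ce] by blast
  \<comment> \<open>\<open>q \<cdot> b\<close> is the composite of the epimorphisms \<open>c\<close>
    and \<open>e\<close>, so its last factor \<open>q\<close> is epic and \<open>Q\<close> is a
    quotient of \<open>B\<close>.\<close>
  have "epic C q"
  proof (rule epicI[OF q(1)])
    fix W g g' assume g: "g \<in> hom C Q W" "g' \<in> hom C Q W" "g \<cdot> q = g' \<cdot> q"
    then have "g \<cdot> (c \<cdot> e) = g' \<cdot> (c \<cdot> e)"
      using assoc[OF ab(3) q(1) g(1)] assoc[OF ab(3) q(1) g(2)] q(2) by simp
    then have "(g \<cdot> c) \<cdot> e = (g' \<cdot> c) \<cdot> e"
      using assoc[OF e c(1) g(1)] assoc[OF e c(1) g(2)] by simp
    then have "g \<cdot> c = g' \<cdot> c"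
      using epicD[OF me(2) e comp_hom[OF c(1) g(1)] comp_hom[OF c(1) g(2)]] by simp
    then show "g = g'" using epicD[OF is_cokernel_epic[OF c(2)] c(1)] g by blast
  qed
  then have "Q \<in> S" using serre_quotient[OF S _ q(1) ab(4)] by blast
  then have "I \<in> S" by (rule serre_extension[OF S jc h(1) c(1) J])
  then show ?thesis using f me(4) e m unfolding Triv_def by blast
qed

end


section \<open>Coreflections and reflections\<close>

lemma hom_full_subcategory:
  "f \<in> hom (full_subcategory C S) X Y \<longleftrightarrow> f \<in> hom C X Y \<and> X \<in> S \<and> Y \<in> S"
  by (auto simp: full_subcategory_def hom_def)

lemma full_subcategory_simps [simp]:
  "Obj (full_subcategory C S) = Obj C \<inter> S" "Id (full_subcategory C S) = Id C"
  "Dom (full_subcategory C S) = Dom C" "Cod (full_subcategory C S) = Cod C"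
  "g \<cdot>\<^bsub>full_subcategory C S\<^esub> f = g \<cdot>\<^bsub>C\<^esub> f"
  by (auto simp: full_subcategory_def)

context pointed
begin

text \<open>The factorisation of \<open>a\<close> is the transpose
  \<open>ArrMap R a \<cdot> \<eta> Z\<close>; naturality of the counit and a triangle identity
  reduce its composite with \<open>\<epsilon> X\<close> to \<open>a\<close>. Existence is enough,
  since the counit is monic.\<close>

lemma coreflection_ex:
  assumes "monocoreflective C S" and X: "X \<in> Obj C"
  obtains R e where "R \<in> S" "e \<in> hom C R X" "monic C e"
    "\<And>Z a. \<lbrakk>Z \<in> S; a \<in> hom C Z X\<rbrakk> \<Longrightarrow> \<exists>b \<in> hom C Z R. a = e \<cdot> b"
proof -
  obtain R \<eta> \<epsilon> where adj: "adjunction (full_subcategory C S) C incl_functor R \<eta> \<epsilon>"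
    and mono: "\<forall>X \<in> Obj C. monic C (\<epsilon> X)"
    using assms(1) unfolding monocoreflective_def by blast
  have R: "\<And>Y. Y \<in> Obj C \<Longrightarrow> ObjMap R Y \<in> S"
    "\<And>f Y Y'. f \<in> hom C Y Y' \<Longrightarrow> ArrMap R f \<in> hom C (ObjMap R Y) (ObjMap R Y')"
    using adj unfolding adjunction_def is_functor_def hom_full_subcategory
    by (auto simp: hom_def)
  \<comment> \<open>The left adjoint is the inclusion, so its triangle identity involves no functor.
    It is available only at objects of \<open>S\<close>, where the unit is defined.\<close>
  have \<eta>: "\<eta> Z \<in> hom C Z (ObjMap R Z)" "\<epsilon> Z \<cdot> \<eta> Z = Id C Z" if "Z \<in> Obj C" "Z \<in> S" for Z
    using adj that unfolding adjunction_def natural_transformation_def hom_full_subcategory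
    by (auto simp: incl_functor_def comp_functor_def)
  have \<epsilon>: "\<And>Y. Y \<in> Obj C \<Longrightarrow> \<epsilon> Y \<in> hom C (ObjMap R Y) Y"
    "\<And>f Y Y'. f \<in> hom C Y Y' \<Longrightarrow> \<epsilon> Y' \<cdot> ArrMap R f = f \<cdot> \<epsilon> Y"
    using adj unfolding adjunction_def natural_transformation_def
    by (auto simp: incl_functor_def comp_functor_def hom_def)
  show ?thesis
  proof (rule that[OF R(1)[OF X] \<epsilon>(1)[OF X]])
    show "monic C (\<epsilon> X)" using mono X by blast
    fix Z a assume Z: "Z \<in> S" and a: "a \<in> hom C Z X"
    have ZC: "Z \<in> Obj C" using hom_objs a by blast
    note n = \<eta>[OF ZC Z]
    have "\<epsilon> X \<cdot> (ArrMap R a \<cdot> \<eta> Z) = (\<epsilon> X \<cdot> ArrMap R a) \<cdot> \<eta> Z"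
      using assoc[OF n(1) R(2)[OF a] \<epsilon>(1)[OF X]] by simp
    also have "\<dots> = a \<cdot> (\<epsilon> Z \<cdot> \<eta> Z)"
      using assoc[OF n(1) \<epsilon>(1)[OF ZC] a] \<epsilon>(2)[OF a] by simp
    also have "\<dots> = a" using n(2) id_right[OF a] by simp
    finally show "\<exists>b \<in> hom C Z (ObjMap R X). a = \<epsilon> X \<cdot> b"
      using comp_hom[OF n(1) R(2)[OF a]] by metis
  qed
qed

text \<open>Here the factorisation of \<open>a\<close> is
  \<open>\<epsilon> Z \<cdot> ArrMap L a\<close>, by naturality of the unit and the triangle
  identity of the inclusion, which is now the right adjoint.\<close>

lemma reflection_ex:
  assumes "epireflective C S" and X: "X \<in> Obj C"
  obtains R e where "R \<in> S" "e \<in> hom C X R" "epic C e"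
    "\<And>Z a. \<lbrakk>Z \<in> S; a \<in> hom C X Z\<rbrakk> \<Longrightarrow> \<exists>b \<in> hom C R Z. a = b \<cdot> e"
proof -
  obtain L \<eta> \<epsilon> where adj: "adjunction C (full_subcategory C S) L incl_functor \<eta> \<epsilon>"
    and epi: "\<forall>X \<in> Obj C. epic C (\<eta> X)"
    using assms(1) unfolding epireflective_def by blast
  have L: "\<And>Y. Y \<in> Obj C \<Longrightarrow> ObjMap L Y \<in> S"
    "\<And>f Y Y'. f \<in> hom C Y Y' \<Longrightarrow> ArrMap L f \<in> hom C (ObjMap L Y) (ObjMap L Y')"
    using adj unfolding adjunction_def is_functor_def hom_full_subcategory
    by (auto simp: hom_def)
  have \<epsilon>: "\<epsilon> Z \<in> hom C (ObjMap L Z) Z" "\<epsilon> Z \<cdot> \<eta> Z = Id C Z" if "Z \<in> Obj C" "Z \<in> S" for Z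
    using adj that unfolding adjunction_def natural_transformation_def hom_full_subcategory
    by (auto simp: incl_functor_def comp_functor_def)
  have \<eta>: "\<And>Y. Y \<in> Obj C \<Longrightarrow> \<eta> Y \<in> hom C Y (ObjMap L Y)"
    "\<And>f Y Y'. f \<in> hom C Y Y' \<Longrightarrow> \<eta> Y' \<cdot> f = ArrMap L f \<cdot> \<eta> Y"
    using adj unfolding adjunction_def natural_transformation_def
    by (auto simp: incl_functor_def comp_functor_def hom_def)
  show ?thesis
  proof (rule that[OF L(1)[OF X] \<eta>(1)[OF X]])
    show "epic C (\<eta> X)" using epi X by blast
    fix Z a assume Z: "Z \<in> S" and a: "a \<in> hom C X Z"
    have ZC: "Z \<in> Obj C" using hom_objs a by blast
    note n = \<epsilon>[OF ZC Z]
    have "(\<epsilon> Z \<cdot> ArrMap L a) \<cdot> \<eta> X = \<epsilon> Z \<cdot> (\<eta> Z \<cdot> a)"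
      using assoc[OF \<eta>(1)[OF X] L(2)[OF a] n(1)] \<eta>(2)[OF a] by simp
    also have "\<dots> = a"
      using assoc[OF a \<eta>(1)[OF ZC] n(1)] n(2) id_left[OF a] by simp
    finally show "\<exists>b \<in> hom C (ObjMap L X) Z. a = b \<cdot> \<eta> X"
      using comp_hom[OF L(2)[OF a] n(1)] by metis
  qed
qed

end


section \<open>The pretorsion theory\<close>

text \<open>As for ordinary kernels, monicity takes care of uniqueness.\<close>

lemma is_Z_kernelI:
  assumes "k \<in> hom C K X" "f \<in> hom C X Y" "f \<cdot>\<^bsub>C\<^esub> k \<in> Triv C \<Z> K Y" "monic C k"
    and "\<And>W l. \<lbrakk>l \<in> hom C W X; f \<cdot>\<^bsub>C\<^esub> l \<in> Triv C \<Z> W Y\<rbrakk> \<Longrightarrow> \<exists>l' \<in> hom C W K. l = k \<cdot>\<^bsub>C\<^esub> l'"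
  shows "is_Z_kernel C \<Z> k f"
proof -
  have "\<exists>!l'. l' \<in> hom C W K \<and> l = k \<cdot>\<^bsub>C\<^esub> l'"
    if "l \<in> hom C W X" "f \<cdot>\<^bsub>C\<^esub> l \<in> Triv C \<Z> W Y" for W l
    using assms(5)[OF that] monicD[OF assms(4,1)] by metis
  then show ?thesis
    using assms(1-3) unfolding is_Z_kernel_def by (auto simp: hom_def)
qed

lemma is_Z_cokernelI:
  assumes "q \<in> hom C X Q" "f \<in> hom C Y X" "q \<cdot>\<^bsub>C\<^esub> f \<in> Triv C \<Z> Y Q" "epic C q"
    and "\<And>W l. \<lbrakk>l \<in> hom C X W; l \<cdot>\<^bsub>C\<^esub> f \<in> Triv C \<Z> Y W\<rbrakk> \<Longrightarrow> \<exists>l' \<in> hom C Q W. l = l' \<cdot>\<^bsub>C\<^esub> q"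
  shows "is_Z_cokernel C \<Z> q f"
proof -
  have "\<exists>!l'. l' \<in> hom C Q W \<and> l = l' \<cdot>\<^bsub>C\<^esub> q"
    if "l \<in> hom C X W" "l \<cdot>\<^bsub>C\<^esub> f \<in> Triv C \<Z> Y W" for W l
    using assms(5)[OF that] epicD[OF assms(4,1)] by metis
  then show ?thesis
    using assms(1-3) unfolding is_Z_cokernel_def by (auto simp: hom_def)
qed

theorem theorem3p2:
  fixes C :: "('o, 'm) category"
    and U V S :: "'o set"
  assumes "pointed_category C"
    and "has_epi_mono_factorisations C"
    and "has_pullbacks C"
    and "has_pushouts C"
    and "pullbacks_preserve_normal_epis C"
    and "pushouts_preserve_normal_monos C"
    and "torsion_theory C U V"
    and "serre_subcategory C S"
    and "monocoreflective C S"
    and "epireflective C S"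
  shows "pretorsion_theory C (extensions C U S) (extensions C S V) \<and>
         extensions C U S \<inter> extensions C S V = S"
proof -
  interpret pointed C
    using assms(1) by (simp add: pointed_category_def pointed_def pointed_axioms_def)
  have UV: "\<And>X Y f. \<lbrakk>X \<in> U; Y \<in> V; f \<in> hom C X Y\<rbrakk> \<Longrightarrow> zero_morphism C f"
    and dec: "\<And>X. X \<in> Obj C \<Longrightarrow>
      \<exists>A \<in> U. \<exists>B \<in> V. \<exists>f \<in> hom C A X. \<exists>g \<in> hom C X B. short_exact C f g"
    using assms(7) unfolding torsion_theory_def by blast+
  have SC: "S \<subseteq> Obj C" using assms(8) by (simp add: serre_subcategory_def)
  note sub = serre_subobject[OF assms(8)] and quot = serre_quotient[OF assms(8)]

  have triv: "f \<in> Triv C S X Y"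
    if X: "X \<in> extensions C U S" and Y: "Y \<in> extensions C S V" and f: "f \<in> hom C X Y" for X Y f
  proof -
    obtain A B a b where ab: "A \<in> U" "B \<in> S" "a \<in> hom C A X" "b \<in> hom C X B" "short_exact C a b"
      using X unfolding extensions_def by blast
    obtain D W s v where sv: "D \<in> S" "W \<in> V" "s \<in> hom C D Y" "v \<in> hom C Y W" "short_exact C s v"
      using Y unfolding extensions_def by blast
    \<comment> \<open>This composite runs from an object of \<open>U\<close> to an object of
      \<open>V\<close>, so the torsion theory makes it zero.\<close>
    have "v \<cdot>\<^bsub>C\<^esub> (f \<cdot>\<^bsub>C\<^esub> a) \<in> hom C A W"
      by (rule comp_hom[OF comp_hom[OF ab(3) f] sv(4)])
    then have "zero_morphism C (v \<cdot>\<^bsub>C\<^esub> (f \<cdot>\<^bsub>C\<^esub> a))" using UV ab sv by blast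
    then show ?thesis
      using Triv_between_extensions[OF assms(2-4,8) ab(5,3,4,2) sv(5,3,4,1) f] by blast
  qed

  have trivial: "extensions C U S \<inter> extensions C S V = S"
  proof (intro equalityI subsetI)
    fix X assume X: "X \<in> extensions C U S \<inter> extensions C S V"
    then have "X \<in> Obj C" by (simp add: extensions_def)
    \<comment> \<open>An object of both classes has an identity that factors through an object of
      \<open>S\<close>, which makes it a subobject of that object.\<close>
    then have "Id C X \<in> Triv C S X X" using triv X id_hom by blast
    then obtain Z a b where Z: "Z \<in> S" "a \<in> hom C X Z" "b \<in> hom C Z X" "Id C X = b \<cdot>\<^bsub>C\<^esub> a"
      unfolding Triv_def by blast
    have "monic C a"
    proof (rule monicI[OF Z(2)])
      fix W f g assume fg: "f \<in> hom C W X" "g \<in> hom C W X" "a \<cdot>\<^bsub>C\<^esub> f = a \<cdot>\<^bsub>C\<^esub> g"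
      then show "f = g"
        using assoc[OF fg(1) Z(2,3)] assoc[OF fg(2) Z(2,3)] Z(4) id_left[OF fg(1)] id_left[OF fg(2)]
        by simp
    qed
    then show "X \<in> S" using sub Z by blast
  next
    fix X assume X: "X \<in> S"
    then obtain A B f g where fg: "A \<in> U" "B \<in> V" "f \<in> hom C A X" "g \<in> hom C X B" "short_exact C f g"
      using dec SC by blast
    have "is_kernel C f g" "is_cokernel C g f" using fg(5) by (auto simp: short_exact_def)
    \<comment> \<open>The single torsion sequence of \<open>X\<close> witnesses both memberships:
      its ends lie in \<open>U\<close> and \<open>V\<close>, and also in \<open>S\<close> as a
      subobject and a quotient of \<open>X\<close>.\<close>
    then have "A \<in> S" "B \<in> S"
      using sub[OF is_kernel_monic fg(3) X] quot[OF is_cokernel_epic fg(4) X] by blast+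
    then show "X \<in> extensions C U S \<inter> extensions C S V"
      using fg X SC unfolding extensions_def by blast
  qed

  have "\<exists>T \<in> extensions C U S. \<exists>F \<in> extensions C S V. \<exists>t \<in> hom C T X. \<exists>q \<in> hom C X F.
      short_Z_exact C S t q" if X: "X \<in> Obj C" for X
  proof -
    obtain A B f g where fg: "A \<in> U" "B \<in> V" "f \<in> hom C A X" "g \<in> hom C X B" "short_exact C f g"
      using dec X by blast
    have AB: "A \<in> Obj C" "B \<in> Obj C" using hom_objs fg by blast+
    obtain M m where m: "M \<in> S" "m \<in> hom C M B" "monic C m"
      "\<And>Z a. \<lbrakk>Z \<in> S; a \<in> hom C Z B\<rbrakk> \<Longrightarrow> \<exists>b \<in> hom C Z M. a = m \<cdot>\<^bsub>C\<^esub> b"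
      by (rule coreflection_ex[OF assms(9) AB(2)], rule that)
    obtain N n where n: "N \<in> S" "n \<in> hom C A N" "epic C n"
      "\<And>Z a. \<lbrakk>Z \<in> S; a \<in> hom C A Z\<rbrakk> \<Longrightarrow> \<exists>b \<in> hom C N Z. a = b \<cdot>\<^bsub>C\<^esub> n"
      by (rule reflection_ex[OF assms(10) AB(1)], rule that)
    obtain T t k e where t: "t \<in> hom C T X" "monic C t" "k \<in> hom C A T" "e \<in> hom C T M"
      "short_exact C k e" "t \<cdot>\<^bsub>C\<^esub> k = f"
      "\<And>Y l b. \<lbrakk>l \<in> hom C Y X; b \<in> hom C Y M; g \<cdot>\<^bsub>C\<^esub> l = m \<cdot>\<^bsub>C\<^esub> b\<rbrakk> \<Longrightarrow> \<exists>h \<in> hom C Y T. l = t \<cdot>\<^bsub>C\<^esub> h"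
      by (rule short_exact_pullback[OF assms(3,5) fg(5,3,4) m(3,2)], rule that)
    obtain F q d c where q: "q \<in> hom C X F" "epic C q" "d \<in> hom C N F" "c \<in> hom C F B"
      "short_exact C d c" "c \<cdot>\<^bsub>C\<^esub> q = g"
      "\<And>Y l b. \<lbrakk>l \<in> hom C X Y; b \<in> hom C N Y; l \<cdot>\<^bsub>C\<^esub> f = b \<cdot>\<^bsub>C\<^esub> n\<rbrakk> \<Longrightarrow> \<exists>h \<in> hom C F Y. l = h \<cdot>\<^bsub>C\<^esub> q"
      by (rule short_exact_pushout[OF assms(4,6) fg(5,3,4) n(3,2)], rule that)
    \<comment> \<open>\<open>T\<close> keeps the kernel \<open>A\<close> from \<open>U\<close> and
      has its quotient \<open>M\<close> in \<open>S\<close>; dually, \<open>F\<close> keeps the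
      quotient \<open>B\<close> from \<open>V\<close> and has its kernel \<open>N\<close> in
      \<open>S\<close>.\<close>
    have T: "T \<in> extensions C U S"
      using hom_objs[OF t(1)] fg(1) m(1) t(3-5) unfolding extensions_def by blast
    have F: "F \<in> extensions C S V"
      using hom_objs[OF q(1)] fg(2) n(1) q(3-5) unfolding extensions_def by blast
    have qt: "q \<cdot>\<^bsub>C\<^esub> t \<in> Triv C S T F" by (rule triv[OF T F comp_hom[OF t(1) q(1)]])
    have "is_Z_kernel C S t q"
    proof (rule is_Z_kernelI[OF t(1) q(1) qt t(2)])
      fix W l assume l: "l \<in> hom C W X" "q \<cdot>\<^bsub>C\<^esub> l \<in> Triv C S W F"
      then obtain Z a b where Z: "Z \<in> S" "a \<in> hom C W Z" "b \<in> hom C Z F" "q \<cdot>\<^bsub>C\<^esub> l = b \<cdot>\<^bsub>C\<^esub> a"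
        unfolding Triv_def by blast
      \<comment> \<open>\<open>c \<cdot> b\<close> runs from an object of \<open>S\<close> to
        \<open>B\<close> and so passes through the coreflection \<open>m\<close>.\<close>
      obtain b' where b': "b' \<in> hom C Z M" "c \<cdot>\<^bsub>C\<^esub> b = m \<cdot>\<^bsub>C\<^esub> b'"
        using m(4)[OF Z(1) comp_hom[OF Z(3) q(4)]] by blast
      have "g \<cdot>\<^bsub>C\<^esub> l = c \<cdot>\<^bsub>C\<^esub> (b \<cdot>\<^bsub>C\<^esub> a)" using assoc[OF l(1) q(1,4)] q(6) Z(4) by simp
      also have "\<dots> = m \<cdot>\<^bsub>C\<^esub> (b' \<cdot>\<^bsub>C\<^esub> a)"
        using assoc[OF Z(2,3) q(4)] assoc[OF Z(2) b'(1) m(2)] b'(2) by simp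
      finally show "\<exists>l' \<in> hom C W T. l = t \<cdot>\<^bsub>C\<^esub> l'"
        using t(7)[OF l(1) comp_hom[OF Z(2) b'(1)]] by blast
    qed
    moreover have "is_Z_cokernel C S q t"
    proof (rule is_Z_cokernelI[OF q(1) t(1) qt q(2)])
      fix W l assume l: "l \<in> hom C X W" "l \<cdot>\<^bsub>C\<^esub> t \<in> Triv C S T W"
      then obtain Z a b where Z: "Z \<in> S" "a \<in> hom C T Z" "b \<in> hom C Z W" "l \<cdot>\<^bsub>C\<^esub> t = b \<cdot>\<^bsub>C\<^esub> a"
        unfolding Triv_def by blast
      \<comment> \<open>\<open>a \<cdot> k\<close> runs from \<open>A\<close> to an object of
        \<open>S\<close> and so passes through the reflection \<open>n\<close>.\<close>
      obtain a' where a': "a' \<in> hom C N Z" "a \<cdot>\<^bsub>C\<^esub> k = a' \<cdot>\<^bsub>C\<^esub> n"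
        using n(4)[OF Z(1) comp_hom[OF t(3) Z(2)]] by blast
      have "l \<cdot>\<^bsub>C\<^esub> f = (b \<cdot>\<^bsub>C\<^esub> a) \<cdot>\<^bsub>C\<^esub> k" using assoc[OF t(3,1) l(1)] t(6) Z(4) by simp
      also have "\<dots> = (b \<cdot>\<^bsub>C\<^esub> a') \<cdot>\<^bsub>C\<^esub> n"
        using assoc[OF t(3) Z(2,3)] assoc[OF n(2) a'(1) Z(3)] a'(2) by simp
      finally show "\<exists>l' \<in> hom C F W. l = l' \<cdot>\<^bsub>C\<^esub> q"
        using q(7)[OF l(1) comp_hom[OF a'(1) Z(3)]] by blast
    qed
    ultimately show ?thesis using T F t(1) q(1) unfolding short_Z_exact_def by blast
  qed
  moreover have "hom C X Y = Triv C S X Y"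
    if "X \<in> extensions C U S" "Y \<in> extensions C S V" for X Y
    using triv[OF that] by (auto simp: Triv_def)
  moreover have "extensions C U S \<subseteq> Obj C" "extensions C S V \<subseteq> Obj C"
    by (auto simp: extensions_def)
  \<comment> \<open>Everything so far is stated relative to \<open>S\<close>; \<open>trivial\<close>
    turns the intersection of the two classes into \<open>S\<close>.\<close>
  ultimately show ?thesis
    unfolding pretorsion_theory_def trivial by (intro conjI ballI iso_closed_extensions refl)
qed

end
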